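(* Let $\Omega$ be an infinite compact metric space and let $T:\Omega\to\Omega$ be a minimal homeomorphism. Suppose $(\Omega,T)$ satisfies the topological repetition property (TRP). Then there exists a residual subset $\mathcal{F}$ of $C(\Omega)$ such that for every $f\in\mathcal{F}$, there is a residual subset $\Omega_f\subseteq\Omega$ with the property that for every $\omega\in\Omega_f$, the potential $V_\omega:\mathbb{Z}\to\mathbb{R}$ defined by $V_\omega(n)=f(T^n\omega)$, $n\in\mathbb{Z}$, is a Gordon potential.
   Context: A homeomorphism $T$ of $\Omega$ is minimal if for every $\omega\in\Omega$ the orbit $\{T^n\omega : n\in\mathbb{Z}\}$ is dense in $\Omega$. $C(\Omega)$ is the space of continuous functions $f:\Omega\to\mathbb{R}$ with the uniform (supremum) norm. A subset of a topological space is residual if it contains a countable intersection of dense open sets. Repetition property: a sequence $\{\omega_k\}_{k\ge 0}$ in $\Omega$ has the repetition property if for every $\varepsilon>0$ and $r>0$ there exists a positive integer $q$ such that $\mathrm{dist}(\omega_k,\omega_{k+q})<\varepsilon$ for $k=0,1,2,\ldots,\lfloor rq\rfloor$. $PRP(\Omega,T)=\{\omega\in\Omega : \{T^k\omega\}_{k\ge 0}\text{ has the repetition property}\}$. $(\Omega,T)$ satisfies the topological repetition property (TRP) if $PRP(\Omega,T)\neq\emptyset$. Gordon potential: a bounded function $V:\mathbb{Z}\to\mathbb{R}$ is called a Gordon potential if there are positive integers $q_k\to\infty$ such that for every $k\ge 1$, both $\max_{1\le n\le q_k}|V(n)-V(n+q_k)|\le k^{-q_k}$ and $\max_{1\le n\le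 q_k}|V(n)-V(n-q_k)|\le k^{-q_k}$. *)

theory Defs
  imports "HOL-Analysis.Analysis"
begin

text \<open>The iterate \<open>T\<^sup>n\<close> for an integer \<open>n\<close>; meaningful for bijective \<open>T\<close>.\<close>

definition iterate :: "('a \<Rightarrow> 'a) \<Rightarrow> int \<Rightarrow> 'a \<Rightarrow> 'a" where
  "iterate T n = (if 0 \<le> n then T ^^ nat n else inv T ^^ nat (- n))"

definition minimal_homeomorphism :: "('a::topological_space \<Rightarrow> 'a) \<Rightarrow> bool" where
  "minimal_homeomorphism T \<longleftrightarrow>
     homeomorphism UNIV UNIV T (inv T) \<and>
     (\<forall>\<omega>. closure (range (\<lambda>n::int. iterate T n \<omega>)) = UNIV)"

definition residual :: "'a::topological_space set \<Rightarrow> bool" where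
  "residual S \<longleftrightarrow>
     (\<exists>\<G>. countable \<G> \<and> (\<forall>U\<in>\<G>. open U \<and> closure U = UNIV) \<and> \<Inter>\<G> \<subseteq> S)"

definition repetition_property :: "(nat \<Rightarrow> 'a::metric_space) \<Rightarrow> bool" where
  "repetition_property s \<longleftrightarrow>
     (\<forall>\<epsilon>>0. \<forall>r>0. \<exists>q>0. \<forall>k. int k \<le> \<lfloor>r * real q\<rfloor> \<longrightarrow> dist (s k) (s (k + q)) < \<epsilon>)"

definition PRP :: "('a::metric_space \<Rightarrow> 'a) \<Rightarrow> 'a set" where
  "PRP T = {\<omega>. repetition_property (\<lambda>k. (T ^^ k) \<omega>)}"

definition TRP :: "('a::metric_space \<Rightarrow> 'a) \<Rightarrow> bool" where
  "TRP T \<longleftrightarrow> PRP T \<noteq> {}"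

text \<open>Only the values \<open>q k\<close> with \<open>k \<ge> 1\<close> are used.\<close>

definition Gordon_potential :: "(int \<Rightarrow> real) \<Rightarrow> bool" where
  "Gordon_potential V \<longleftrightarrow>
     bounded (range V) \<and>
     (\<exists>q :: nat \<Rightarrow> nat.
        (\<forall>k\<ge>1. q k > 0) \<and>
        filterlim q at_top sequentially \<and>
        (\<forall>k\<ge>1.
           Max ((\<lambda>n. \<bar>V n - V (n + int (q k))\<bar>) ` {1..int (q k)}) \<le> real k powi (- int (q k)) \<and>
           Max ((\<lambda>n. \<bar>V n - V (n - int (q k))\<bar>) ` {1..int (q k)}) \<le> real k powi (- int (q k))))"

end

theory Submission
  imports Defs
begin

text \<open>
  Fix \<open>x\<close> in the nonempty set \<open>PRP T\<close> and write \<open>x\<^sub>j = T\<^sup>j x\<close>. The repetition property yields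
  arbitrarily large \<open>q\<close> for which \<open>x\<^sub>0, \<dots>, x\<^bsub>4q\<^esub>\<close> almost repeats with period \<open>q\<close>, but ``almost'' is
  only an arbitrary \<open>\<epsilon>\<close>, far from the accuracy \<open>m\<^bsup>-q\<^esup>\<close> that a Gordon potential demands. The missing
  accuracy is gained by choosing the sampling function \<open>f\<close> generically: because the points
  \<open>x\<^sub>0, \<dots>, x\<^bsub>4q\<^esub>\<close> are finitely many and distinct, a uniformly small change of \<open>f\<close>, obtained from
  Tietze's theorem, makes \<open>f(x\<^sub>j)\<close> \<^emph>\<open>exactly\<close> \<open>q\<close>-periodic on this stretch. A strict inequality between
  finitely many values of \<open>f\<close> is an open condition, so for each \<open>m\<close> the functions that repeat with
  accuracy \<open>m\<^bsup>-q\<^esup>\<close> for some \<open>q > m\<close> form an open dense set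
  (\<open>open_sharply_repeating\<close>, \<open>dense_sharply_repeating\<close>), and their intersection is the residual
  set of sampling functions.

  For such an \<open>f\<close>, the stretch of length \<open>4q\<close> is long enough that every \<open>x\<^sub>b\<close> with \<open>q \<le> b < 2q\<close>
  satisfies both Gordon inequalities with this \<open>q\<close>. In a minimal system on a compact space, an
  open set is visited by every orbit segment of a certain length (\<open>minimal_visits\<close>), so these
  base points meet every open set once \<open>q\<close> is large. The points satisfying the two inequalities
  for a given \<open>m\<close> and some \<open>q > m\<close> therefore form an open dense set (\<open>open_Gordon_points\<close>,
  \<open>dense_Gordon_points\<close>), and a point in the intersection over all \<open>m\<close> has a Gordon potential.

  The infinitude of the space enters through the absence of periodic points
  (\<open>minimal_orbit_inj\<close>). It makes the points \<open>x\<^sub>j\<close> distinct, and it forces the repetition times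
  \<open>q\<close> to grow when \<open>\<epsilon>\<close> shrinks.
\<close>

section \<open>Orbits of a minimal homeomorphism\<close>

text \<open>
  The index starts at 1 because the accuracy \<open>m\<^bsup>-q\<^esup>\<close>, written \<open>inverse (real m ^ q)\<close>, is 0 for
  \<open>m = 0 < q\<close>, and the strict inequalities used below have no solutions at that level.
\<close>

lemma residual_INT_open_dense:
  fixes A :: "nat \<Rightarrow> 'a::topological_space set"
  assumes "\<And>m. m \<ge> 1 \<Longrightarrow> open (A m)" "\<And>m. m \<ge> 1 \<Longrightarrow> closure (A m) = UNIV"
  shows "residual (\<Inter>m\<in>{1..}. A m)"
  unfolding residual_def using assms by (intro exI[of _ "A ` {1..}"]) auto

lemma minimal_homeomorphism_bij: "minimal_homeomorphism T \<Longrightarrow> bij T"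
  unfolding minimal_homeomorphism_def homeomorphism_def
  by (intro bijI') (metis UNIV_I, metis UNIV_I)

lemma iterate_funpow:
  assumes "bij T" "n + int j \<ge> 0"
  shows "iterate T n ((T ^^ j) y) = (T ^^ nat (n + int j)) y"
proof (cases "n \<ge> 0")
  case True
  then have "nat (n + int j) = nat n + j" by simp
  with True show ?thesis by (simp add: iterate_def funpow_add)
next
  case False
  define k where "k = nat (- n)"
  have j: "j = k + nat (n + int j)" using False assms(2) by (simp add: k_def)
  have "iterate T n ((T ^^ j) y) = (inv T ^^ k) ((T ^^ k) ((T ^^ nat (n + int j)) y))"
    using False by (subst j) (simp add: iterate_def k_def funpow_add)
  also have "\<dots> = (T ^^ nat (n + int j)) y"
    using inv_fn_o_fn_is_id[OF assms(1), of k] by (metis comp_apply)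
  finally show ?thesis .
qed

lemma continuous_on_funpow_self:
  assumes "continuous_on UNIV (f :: 'a::topological_space \<Rightarrow> 'a)"
  shows "continuous_on UNIV (f ^^ k)"
proof (induction k)
  case (Suc k)
  then show ?case
    using assms continuous_on_compose2[of UNIV f UNIV "f ^^ k"] by (simp add: o_def)
qed (simp add: id_def)

lemma continuous_on_iterate:
  assumes "minimal_homeomorphism T"
  shows "continuous_on UNIV (iterate T n)"
  using assms continuous_on_funpow_self
  unfolding minimal_homeomorphism_def homeomorphism_def iterate_def by auto

text \<open>
  By minimality the preimages of \<open>U\<close> under all iterates cover the space, so by compactness finitely
  many of them do, say for times in \<open>[-M, M]\<close>. Applying this at \<open>T\<^sup>M y\<close> instead of \<open>y\<close> turns
  them into the nonnegative times \<open>[0, 2M]\<close>.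
\<close>

lemma minimal_visits:
  fixes T :: "'a::topological_space \<Rightarrow> 'a"
  assumes "compact (UNIV :: 'a set)" "minimal_homeomorphism T" "open U" "U \<noteq> {}"
  obtains N where "\<And>y. \<exists>j\<le>N. (T ^^ j) y \<in> U"
proof -
  have hit: "\<exists>n. iterate T n y \<in> U" for y
  proof -
    have "U \<inter> closure (range (\<lambda>n. iterate T n y)) \<noteq> {}"
      using assms(2,4) by (simp add: minimal_homeomorphism_def)
    then show ?thesis using assms(3) by (auto simp: open_Int_closure_eq_empty)
  qed
  have "open (iterate T n -` U)" for n
    using continuous_on_iterate[OF assms(2)] assms(3) by (simp add: open_vimage)
  moreover have "UNIV \<subseteq> (\<Union>n. iterate T n -` U)" using hit by auto
  ultimately obtain I where I: "finite I" "UNIV \<subseteq> (\<Union>n\<in>I. iterate T n -` U)"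
    using compactE_image[OF assms(1), of UNIV "\<lambda>n. iterate T n -` U"] by auto
  define M where "M = (\<Sum>n\<in>I. nat \<bar>n\<bar>)"
  have M: "\<bar>n\<bar> \<le> int M" if "n \<in> I" for n
    using member_le_sum[OF that, of abs] I(1) by (simp add: M_def)
  have "\<exists>j\<le>2 * M. (T ^^ j) y \<in> U" for y
  proof -
    obtain n where n: "n \<in> I" "iterate T n ((T ^^ M) y) \<in> U" using I(2) by blast
    with M[of n] show ?thesis
      by (intro exI[of _ "nat (n + int M)"])
        (auto simp: iterate_funpow[OF minimal_homeomorphism_bij[OF assms(2)]])
  qed
  then show thesis by (rule that)
qed

text \<open>
  A periodic orbit is finite, hence closed, and by minimality it would be the whole infinite space.
\<close>

lemma minimal_orbit_inj:
  fixes T :: "'a::t1_space \<Rightarrow> 'a"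
  assumes "infinite (UNIV :: 'a set)" "minimal_homeomorphism T"
  shows "inj (\<lambda>j. (T ^^ j) x)"
proof -
  have bij: "bij T" by (rule minimal_homeomorphism_bij[OF assms(2)])
  have aperiodic: "(T ^^ p) x \<noteq> x" if "p > 0" for p
  proof
    assume per: "(T ^^ p) x = x"
    define S where "S = (\<lambda>i. (T ^^ i) x) ` {..<p}"
    have TS: "T y \<in> S" if "y \<in> S" for y
    proof -
      obtain i where i: "i < p" "y = (T ^^ i) x" using \<open>y \<in> S\<close> by (auto simp: S_def)
      have Ty: "T y = (T ^^ Suc i) x" using i by simp
      show ?thesis
      proof (cases "Suc i = p")
        case True
        with Ty per have "T y = (T ^^ 0) x" by simp
        then show ?thesis using \<open>p > 0\<close> unfolding S_def by blast
      next
        case False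
        with i Ty show ?thesis unfolding S_def by (intro image_eqI[of _ _ "Suc i"]) auto
      qed
    qed
    have iS: "inv T y \<in> S" if "y \<in> S" for y
    proof -
      obtain i where i: "i < p" "y = (T ^^ i) x" using \<open>y \<in> S\<close> by (auto simp: S_def)
      obtain k where k: "k < p" "y = (T ^^ Suc k) x"
      proof (cases i)
        case 0
        with i per \<open>p > 0\<close> show thesis by (intro that[of "p - 1"]) auto
      next
        case (Suc k)
        with i show thesis by (intro that[of k]) auto
      qed
      have "inv T y = (T ^^ k) x" using k bij by (simp add: bij_is_inj)
      with k show ?thesis by (auto simp: S_def)
    qed
    have x: "x \<in> S" using \<open>p > 0\<close> by (auto simp: S_def intro!: image_eqI[of _ _ 0])
    have "(T ^^ k) x \<in> S" "(inv T ^^ k) x \<in> S" for k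
      by (induction k) (auto simp: x TS iS)
    then have "range (\<lambda>n. iterate T n x) \<subseteq> S" by (auto simp: iterate_def)
    moreover have "finite S" by (simp add: S_def)
    ultimately have "closure (range (\<lambda>n. iterate T n x)) \<subseteq> S"
      by (simp add: closure_minimal finite_imp_closed)
    with \<open>finite S\<close> assms show False
      by (metis finite_subset minimal_homeomorphism_def)
  qed
  have "i = j" if "(T ^^ i) x = (T ^^ j) x" "i \<le> j" for i j
  proof -
    have "(T ^^ i) ((T ^^ (j - i)) x) = (T ^^ i) x"
      using that by (metis comp_apply funpow_add le_add_diff_inverse)
    then have "(T ^^ (j - i)) x = x"
      using inj_fn[OF bij_is_inj[OF bij], of i] by (simp add: inj_eq)
    with aperiodic that(2) show ?thesis by (metis le_neq_implies_less zero_less_diff)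
  qed
  then show ?thesis by (intro injI) (metis nle_le)
qed

section \<open>Generic sampling functions\<close>

text \<open>
  Asking for an error below the distances from \<open>x 0\<close> to \<open>x 1, \<dots>, x m\<close> rules out
  \<open>q = 1, \<dots>, m\<close>.
\<close>

lemma repetition_property_large:
  fixes x :: "nat \<Rightarrow> 'a::metric_space"
  assumes "repetition_property x" "inj x" "e > 0"
  obtains q where "q > m" "\<And>k. k \<le> 3 * q \<Longrightarrow> dist (x k) (x (k + q)) < e"
proof -
  define d where "d = Min (insert e ((\<lambda>p. dist (x 0) (x p)) ` {1..m}))"
  have "d > 0" unfolding d_def using assms(2,3) by (auto simp: inj_eq)
  moreover have "(3::real) > 0" by simp
  ultimately obtain q where q: "q > 0"
    "\<And>k. int k \<le> \<lfloor>3 * real q\<rfloor> \<Longrightarrow> dist (x k) (x (k + q)) < d"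
    using assms(1) unfolding repetition_property_def by metis
  have "\<lfloor>3 * real q\<rfloor> = int (3 * q)" by (metis floor_of_nat of_nat_mult of_nat_numeral)
  then have q': "dist (x k) (x (k + q)) < d" if "k \<le> 3 * q" for k
    using q(2) that by simp
  have "d \<le> e" by (simp add: d_def)
  moreover have "q > m"
  proof (rule ccontr)
    assume "\<not> m < q"
    then have "dist (x 0) (x q) \<in> insert e ((\<lambda>p. dist (x 0) (x p)) ` {1..m})" using q(1) by auto
    then have "d \<le> dist (x 0) (x q)" unfolding d_def by (intro Min_le) auto
    with q'[of 0] show False by simp
  qed
  ultimately show thesis using q' by (intro that[of q]) force+
qed

lemma bcontfun_interpolate_finite:
  fixes c :: "'a::metric_space \<Rightarrow> real"
  assumes "finite S" "\<And>s. s \<in> S \<Longrightarrow> \<bar>c s\<bar> \<le> e" "e \<ge> 0"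
  obtains h :: "'a \<Rightarrow>\<^sub>C real"
  where "\<And>s. s \<in> S \<Longrightarrow> apply_bcontfun h s = c s" "norm h \<le> e"
proof -
  have "normal_space (euclidean :: 'a topology)"
    by (simp add: metrizable_imp_normal_space metrizable_space_euclidean)
  moreover have "closedin euclidean S" using assms(1) by (simp add: finite_imp_closed)
  moreover have "continuous_map (subtopology euclidean S) euclideanreal c"
    using assms(1) by (simp add: continuous_on_finite)
  moreover have "c ` S \<subseteq> {-e..e}" using assms(2) by (force simp: abs_le_iff)
  ultimately obtain g where g: "continuous_map euclidean euclideanreal g"
      "\<And>s. s \<in> S \<Longrightarrow> g s = c s" "g ` topspace euclidean \<subseteq> {-e..e}"
    using assms(3) Tietze_extension_closed_real_interval[of euclidean S c "- e" e thesis] by auto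
  have b: "norm (g y) \<le> e" for y
  proof -
    have "g y \<in> {-e..e}" using g(3) by (rule subsetD) simp
    then show ?thesis by (simp add: abs_le_iff)
  qed
  moreover have "continuous_on UNIV g" using g(1) by simp
  ultimately have "g \<in> bcontfun" by (rule bcontfun_normI[rotated])
  then have "apply_bcontfun (Bcontfun g) = g" by (simp add: Bcontfun_inverse)
  then show thesis using g(2) b by (intro that[of "Bcontfun g"]) (auto intro!: norm_bound)
qed

text \<open>
  The range \<open>j \<le> 3q\<close> leaves room for a window of \<open>q\<close> indices, compared with its translates by
  \<open>q\<close> and \<open>-q\<close>, to start at any base index between \<open>q\<close> and \<open>2q\<close>.
\<close>

definition sharply_repeating :: "(nat \<Rightarrow> 'a::metric_space) \<Rightarrow> nat \<Rightarrow> ('a \<Rightarrow>\<^sub>C real) set" where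
  "sharply_repeating x m = {f. \<exists>q>m. \<forall>j\<le>3 * q.
     \<bar>apply_bcontfun f (x j) - apply_bcontfun f (x (j + q))\<bar> < inverse (real m ^ q)}"

lemma continuous_on_eval_bcontfun:
  "continuous_on UNIV (\<lambda>f :: 'a::metric_space \<Rightarrow>\<^sub>C real. apply_bcontfun f y)"
  unfolding continuous_on_iff
  by (metis dist_fun_lt_imp_dist_val_lt)

lemma open_sharply_repeating: "open (sharply_repeating x m)"
proof -
  have "sharply_repeating x m = (\<Union>q\<in>{m<..}. \<Inter>j\<in>{..3 * q}.
      {f. \<bar>apply_bcontfun f (x j) - apply_bcontfun f (x (j + q))\<bar> < inverse (real m ^ q)})"
    by (auto simp: sharply_repeating_def)
  also have "open \<dots>"
    by (intro open_UN open_INT ballI open_Collect_less continuous_intros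
        continuous_on_eval_bcontfun) auto
  finally show ?thesis .
qed

text \<open>
  At most four steps of length \<open>q\<close> lead from \<open>x (j mod q)\<close> to \<open>x j\<close> for \<open>j \<le> 4q\<close>, each of them
  short, so by uniform continuity \<open>f\<close> changes little between these two points. Hence a small correction,
  prescribed at the distinct points \<open>x 0, \<dots>, x (4q)\<close>, replaces the value at \<open>x j\<close> by the one at
  \<open>x (j mod q)\<close>, and the corrected function repeats without any error.
\<close>

lemma dense_sharply_repeating:
  fixes x :: "nat \<Rightarrow> 'a::metric_space"
  assumes "compact (UNIV :: 'a set)" "repetition_property x" "inj x" "m \<ge> 1"
  shows "closure (sharply_repeating x m) = UNIV"
proof -
  have "\<exists>g\<in>sharply_repeating x m. dist g f < e" if "e > 0" for f e
  proof -
    let ?f = "apply_bcontfun f"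
    have "uniformly_continuous_on UNIV ?f"
      by (intro compact_uniformly_continuous assms(1)) simp
    then obtain d where d: "d > 0" "\<And>y z. dist y z < d \<Longrightarrow> dist (?f y) (?f z) < e / 2"
      using \<open>e > 0\<close> unfolding uniformly_continuous_on_def
      by (metis UNIV_I dist_commute half_gt_zero)
    have "d / 5 > 0" using d(1) by simp
    from repetition_property_large[OF assms(2,3) this]
    obtain q where q: "q > m" "\<And>k. k \<le> 3 * q \<Longrightarrow> dist (x k) (x (k + q)) < d / 5"
      by blast
    have steps: "dist (x i) (x (i + l * q)) \<le> real l * (d / 5)" if "i + l * q \<le> 4 * q" for i l
      using that
    proof (induction l)
      case (Suc l)
      have "dist (x i) (x (i + Suc l * q)) \<le>
          dist (x i) (x (i + l * q)) + dist (x (i + l * q)) (x (i + l * q + q))"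
        using dist_triangle[of "x i" "x (i + l * q + q)" "x (i + l * q)"]
        by (simp add: algebra_simps)
      also have "\<dots> \<le> real l * (d / 5) + d / 5"
        using Suc q(2)[of "i + l * q"] by (intro add_mono) auto
      finally show ?case by (simp add: algebra_simps)
    qed simp
    have near: "dist (x (j mod q)) (x j) < d" if "j \<le> 4 * q" for j
    proof -
      have "j div q \<le> 4" using div_le_mono[OF that, of q] q(1) by simp
      then have "real (j div q) * (d / 5) \<le> 4 * (d / 5)"
        using d(1) by (intro mult_right_mono) auto
      moreover have "dist (x (j mod q)) (x j) \<le> real (j div q) * (d / 5)"
        using steps[of "j mod q" "j div q"] that by simp
      ultimately show ?thesis using d(1) by linarith
    qed
    define c where "c y = ?f (x (inv x y mod q)) - ?f y" for y
    have c: "c (x j) = ?f (x (j mod q)) - ?f (x j)" for j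
      using assms(3) by (simp add: c_def)
    have "\<bar>c y\<bar> \<le> e / 2" if "y \<in> x ` {..4 * q}" for y
      using that d(2)[OF near] by (force simp: c dist_real_def)
    then obtain h where h: "\<And>y. y \<in> x ` {..4 * q} \<Longrightarrow> apply_bcontfun h y = c y" "norm h \<le> e / 2"
      using bcontfun_interpolate_finite[of "x ` {..4 * q}" c "e / 2"] \<open>e > 0\<close> by auto
    have g: "apply_bcontfun (f + h) (x j) = ?f (x (j mod q))" if "j \<le> 4 * q" for j
      using h(1)[of "x j"] that by (simp add: c plus_bcontfun.rep_eq)
    have "f + h \<in> sharply_repeating x m"
      unfolding sharply_repeating_def
    proof (intro CollectI exI[of _ q] conjI allI impI)
      fix j assume "j \<le> 3 * q"
      then show "\<bar>apply_bcontfun (f + h) (x j) - apply_bcontfun (f + h) (x (j + q))\<bar>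
          < inverse (real m ^ q)"
        using g[of j] g[of "j + q"] assms(4) by simp
    qed (use q in auto)
    moreover have "dist (f + h) f < e" using h(2) \<open>e > 0\<close> by (simp add: dist_norm)
    ultimately show ?thesis by blast
  qed
  then show ?thesis by (auto simp: closure_approachable)
qed

section \<open>Generic base points\<close>

definition Gordon_points :: "('a::metric_space \<Rightarrow> 'a) \<Rightarrow> ('a \<Rightarrow>\<^sub>C real) \<Rightarrow> nat \<Rightarrow> 'a set" where
  "Gordon_points T f m = {\<omega>. \<exists>q>m. \<forall>n\<in>{1..int q}. \<forall>s\<in>{int q, - int q}.
     \<bar>apply_bcontfun f (iterate T n \<omega>) - apply_bcontfun f (iterate T (n + s) \<omega>)\<bar>
       < inverse (real m ^ q)}"

lemma open_Gordon_points:
  assumes "minimal_homeomorphism T"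
  shows "open (Gordon_points T f m)"
proof -
  have "Gordon_points T f m = (\<Union>q\<in>{m<..}. \<Inter>n\<in>{1..int q}. \<Inter>s\<in>{int q, - int q}.
      {\<omega>. \<bar>apply_bcontfun f (iterate T n \<omega>) - apply_bcontfun f (iterate T (n + s) \<omega>)\<bar>
        < inverse (real m ^ q)})"
    unfolding Gordon_points_def by blast
  also have "open \<dots>"
    by (intro open_UN open_INT ballI open_Collect_less continuous_intros
        continuous_on_compose2[OF continuous_on_apply_bcontfun[of UNIV]]
        continuous_on_iterate[OF assms]) auto
  finally show ?thesis .
qed

text \<open>
  The inequalities at a base point \<open>x\<^sub>b\<close> involve \<open>x\<^sub>j\<close> with \<open>b - q < j \<le> b + 2q\<close>, which stays within
  \<open>0 \<le> j \<le> 4q\<close> for \<open>q \<le> b \<le> 2q\<close>. A given open set contains such an \<open>x\<^sub>b\<close> as soon as \<open>q\<close> exceeds its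
  visiting time \<open>N\<close>, which is why \<open>f\<close> is used at a level \<open>M\<close> beyond both \<open>m\<close> and \<open>N\<close>.
\<close>

lemma dense_Gordon_points:
  fixes T :: "'a::metric_space \<Rightarrow> 'a"
  assumes "compact (UNIV :: 'a set)" "minimal_homeomorphism T" "m \<ge> 1"
    and f: "\<And>M. M \<ge> 1 \<Longrightarrow> f \<in> sharply_repeating (\<lambda>j. (T ^^ j) x) M"
  shows "closure (Gordon_points T f m) = UNIV"
proof -
  have "U \<inter> Gordon_points T f m \<noteq> {}" if U: "open U" "U \<noteq> {}" for U
  proof -
    obtain N where N: "\<And>y. \<exists>j\<le>N. (T ^^ j) y \<in> U"
      using minimal_visits[OF assms(1,2) U] by blast
    define M where "M = max m N"
    have "M \<ge> 1" using assms(3) by (simp add: M_def)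
    from f[OF this] obtain q where q: "q > M"
      "\<And>j. j \<le> 3 * q \<Longrightarrow> \<bar>apply_bcontfun f ((T ^^ j) x) - apply_bcontfun f ((T ^^ (j + q)) x)\<bar>
         < inverse (real M ^ q)"
      by (auto simp: sharply_repeating_def)
    obtain j where j: "j \<le> N" "(T ^^ j) ((T ^^ q) x) \<in> U" using N by blast
    define b where "b = j + q"
    have b: "q \<le> b" "b \<le> 2 * q" "(T ^^ b) x \<in> U"
      using j q(1) by (auto simp: b_def M_def funpow_add)
    have "inverse (real M ^ q) \<le> inverse (real m ^ q)"
      using assms(3) by (intro le_imp_inverse_le power_mono) (auto simp: M_def)
    note repeat = less_le_trans[OF q(2) this]
    have shift: "iterate T n ((T ^^ b) x) = (T ^^ nat (n + int b)) x" if "n + int b \<ge> 0" for n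
      using iterate_funpow[OF minimal_homeomorphism_bij[OF assms(2)] that] .
    have "(T ^^ b) x \<in> Gordon_points T f m"
      unfolding Gordon_points_def
    proof (intro CollectI exI[of _ q] conjI ballI)
      show "m < q" using q(1) by (simp add: M_def)
    next
      fix n s assume n: "n \<in> {1..int q}" and s: "s \<in> {int q, - int q}"
      define i where "i = nat (n + int b)"
      have i: "q \<le> i" "i \<le> 3 * q" "n + int b = int i"
        using n b by (auto simp: i_def)
      from s show "\<bar>apply_bcontfun f (iterate T n ((T ^^ b) x)) -
          apply_bcontfun f (iterate T (n + s) ((T ^^ b) x))\<bar> < inverse (real m ^ q)"
      proof (elim insertE emptyE)
        assume s: "s = int q"
        have "n + s + int b = int (i + q)" using i s by simp
        then show ?thesis using repeat[of i] i by (simp add: shift del: of_nat_add)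
      next
        assume s: "s = - int q"
        have "n + s + int b = int (i - q)" using i s by simp
        then show ?thesis using repeat[of "i - q"] i
          by (simp add: shift abs_minus_commute del: of_nat_diff)
      qed
    qed
    with b(3) show ?thesis by blast
  qed
  from this[of "- closure (Gordon_points T f m)"] show ?thesis
    using closure_subset[of "Gordon_points T f m"] open_Compl[OF closed_closure] by blast
qed

lemma Gordon_potential_if_Gordon_points:
  assumes "\<And>m. m \<ge> 1 \<Longrightarrow> \<omega> \<in> Gordon_points T f m"
  shows "Gordon_potential (\<lambda>n. apply_bcontfun f (iterate T n \<omega>))"
proof -
  let ?V = "\<lambda>n. apply_bcontfun f (iterate T n \<omega>)"
  have "\<exists>q>m. \<forall>n\<in>{1..int q}. \<forall>s\<in>{int q, - int q}. \<bar>?V n - ?V (n + s)\<bar> < inverse (real m ^ q)"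
    if "m \<ge> 1" for m
    using assms[OF that] by (simp add: Gordon_points_def)
  then obtain q where q: "\<And>m. m \<ge> 1 \<Longrightarrow> q m > m"
    "\<And>m n s. m \<ge> 1 \<Longrightarrow> n \<in> {1..int (q m)} \<Longrightarrow> s \<in> {int (q m), - int (q m)} \<Longrightarrow>
       \<bar>?V n - ?V (n + s)\<bar> < inverse (real m ^ q m)"
    by metis
  have "bounded (range ?V)"
    by (rule bounded_subset[of "range (apply_bcontfun f)"])
      (use apply_bcontfun[of f] in \<open>auto simp: bcontfun_def\<close>)
  moreover have "q k > 0" if "k \<ge> 1" for k using q(1)[OF that] by simp
  moreover have "filterlim q at_top sequentially"
    by (rule filterlim_at_top_mono[OF filterlim_ident])
      (use q(1) in \<open>auto simp: eventually_sequentially intro!: exI[of _ 1] less_imp_le\<close>)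
  moreover have "Max ((\<lambda>n. \<bar>?V n - ?V (n + s)\<bar>) ` {1..int (q k)}) \<le> real k powi (- int (q k))"
    if "k \<ge> 1" "s \<in> {int (q k), - int (q k)}" for k s
    using q(2)[OF that(1) _ that(2)] q(1)[OF that(1)]
    by (subst Max_le_iff) (auto simp: power_int_minus intro!: less_imp_le)
  from this[of _ "int (q _)"] this[of _ "- int (q _)"]
  have "Max ((\<lambda>n. \<bar>?V n - ?V (n + int (q k))\<bar>) ` {1..int (q k)}) \<le> real k powi (- int (q k))"
    "Max ((\<lambda>n. \<bar>?V n - ?V (n - int (q k))\<bar>) ` {1..int (q k)}) \<le> real k powi (- int (q k))"
    if "k \<ge> 1" for k using that by auto
  ultimately show ?thesis unfolding Gordon_potential_def by blast
qed

theorem theorem1: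
  fixes T :: "'a::metric_space \<Rightarrow> 'a"
  assumes "compact (UNIV :: 'a set)"
    and "infinite (UNIV :: 'a set)"
    and "minimal_homeomorphism T"
    and "TRP T"
  shows "\<exists>\<F> :: ('a \<Rightarrow>\<^sub>C real) set. residual \<F> \<and>
    (\<forall>f\<in>\<F>. \<exists>\<Omega>\<^sub>f :: 'a set. residual \<Omega>\<^sub>f \<and>
      (\<forall>\<omega>\<in>\<Omega>\<^sub>f. Gordon_potential (\<lambda>n::int. apply_bcontfun f (iterate T n \<omega>))))"
proof -
  obtain x where x: "repetition_property (\<lambda>j. (T ^^ j) x)"
    using assms(4) by (auto simp: TRP_def PRP_def)
  define W where "W = sharply_repeating (\<lambda>j. (T ^^ j) x)"
  show ?thesis
  proof (intro exI[of _ "\<Inter>m\<in>{1..}. W m"] conjI ballI)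
    show "residual (\<Inter>m\<in>{1..}. W m)"
      unfolding W_def
      by (intro residual_INT_open_dense open_sharply_repeating
          dense_sharply_repeating[OF assms(1) x minimal_orbit_inj[OF assms(2,3)]])
  next
    fix f assume "f \<in> (\<Inter>m\<in>{1..}. W m)"
    then have f: "f \<in> sharply_repeating (\<lambda>j. (T ^^ j) x) M" if "M \<ge> 1" for M
      using that by (auto simp: W_def)
    have "residual (\<Inter>m\<in>{1..}. Gordon_points T f m)"
      by (intro residual_INT_open_dense open_Gordon_points[OF assms(3)]
          dense_Gordon_points[OF assms(1,3) _ f])
    moreover have "Gordon_potential (\<lambda>n. apply_bcontfun f (iterate T n \<omega>))"
      if "\<omega> \<in> (\<Inter>m\<in>{1..}. Gordon_points T f m)" for \<omega>
      using that by (intro Gordon_potential_if_Gordon_points) auto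
    ultimately show "\<exists>\<Omega>\<^sub>f. residual \<Omega>\<^sub>f \<and>
        (\<forall>\<omega>\<in>\<Omega>\<^sub>f. Gordon_potential (\<lambda>n. apply_bcontfun f (iterate T n \<omega>)))"
      by blast
  qed
qed

end
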